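(* Let $S$ be a $*$-monoid and let $a,b,c\in S$. Then $a$ is $(b,c)$-core invertible if and only if $a$ is left $(b,c)$-invertible and $c$ is $\{1,3\}$-invertible with $abs\in c\{1,3\}$ for some $s\in S$. In this case, the $(b,c)$-core inverse of $a$ is $$a_{(b,c)}^{\#}=a_l^{(b,c)}c^{(1,3)}=br^*,$$ where $r\in S$ satisfies $c=r(cab)^*c$.
   Context: A $*$-monoid is a monoid $S$ with unity $1$ and an involution $*:S\to S$ satisfying $(a^* )^*=a$ and $(ab)^*=b^*a^*$. $a$ is $(b,c)$-core invertible if there exists $x\in S$ such that $caxc=c$, $xS=bS$ and $Sx=Sc^{*}$; such an $x$ is unique when it exists, is called the $(b,c)$-core inverse of $a$, and is denoted here $a_{(b,c)}^{\#}$. $a$ is left $(b,c)$-invertible if $b\in Scab$, i.e. there exists $x\in Sc$ with $b=xab$; any such $x$ is called a left $(b,c)$-inverse of $a$ and denoted $a_l^{(b,c)}$. A $\{1,3\}$-inverse of $c$ is $y\in S$ with $cyc=c$ and $(cy)^*=cy$; $c^{(1,3)}$ denotes any $\{1,3\}$-inverse of $c$, $c\{1,3\}$ denotes the set of all of them, and $c$ is $\{1,3\}$-invertible if this set is nonempty. *)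

theory Defs
  imports Main
begin

class star_monoid = monoid_mult +
  fixes star :: "'a \<Rightarrow> 'a"  ("(_\<^sup>\<star>)" [1000] 999)
  assumes star_star: "(a\<^sup>\<star>)\<^sup>\<star> = a"
    and star_mult: "(a * b)\<^sup>\<star> = b\<^sup>\<star> * a\<^sup>\<star>"

text \<open>The principal one-sided ideals \<open>x S\<close> and \<open>S x\<close>, where \<open>S\<close> is the whole type.\<close>

definition right_ideal :: "'a::monoid_mult \<Rightarrow> 'a set" where
  "right_ideal x = {x * s | s. True}"

definition left_ideal :: "'a::monoid_mult \<Rightarrow> 'a set" where
  "left_ideal x = {s * x | s. True}"

definition is_core_inverse :: "'a::star_monoid \<Rightarrow> 'a \<Rightarrow> 'a \<Rightarrow> 'a \<Rightarrow> bool" where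
  "is_core_inverse a b c x \<longleftrightarrow>
     c * a * x * c = c \<and> right_ideal x = right_ideal b \<and> left_ideal x = left_ideal (c\<^sup>\<star>)"

definition core_invertible :: "'a::star_monoid \<Rightarrow> 'a \<Rightarrow> 'a \<Rightarrow> bool" where
  "core_invertible a b c \<longleftrightarrow> (\<exists>x. is_core_inverse a b c x)"

text \<open>Meaningful only if \<open>a\<close> is \<open>(b,c)\<close>-core invertible; uniqueness is shown below.\<close>

definition core_inverse :: "'a::star_monoid \<Rightarrow> 'a \<Rightarrow> 'a \<Rightarrow> 'a" where
  "core_inverse a b c = (THE x. is_core_inverse a b c x)"

definition left_invertible :: "'a::monoid_mult \<Rightarrow> 'a \<Rightarrow> 'a \<Rightarrow> bool" where
  "left_invertible a b c \<longleftrightarrow> b \<in> left_ideal (c * a * b)"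

definition is_left_inverse :: "'a::monoid_mult \<Rightarrow> 'a \<Rightarrow> 'a \<Rightarrow> 'a \<Rightarrow> bool" where
  "is_left_inverse a b c x \<longleftrightarrow> x \<in> left_ideal c \<and> b = x * a * b"

definition inverses13 :: "'a::star_monoid \<Rightarrow> 'a set" where
  "inverses13 c = {y. c * y * c = c \<and> (c * y)\<^sup>\<star> = c * y}"

definition invertible13 :: "'a::star_monoid \<Rightarrow> bool" where
  "invertible13 c \<longleftrightarrow> inverses13 c \<noteq> {}"

lemma left_invertible_iff: "left_invertible a b c \<longleftrightarrow> (\<exists>x. is_left_inverse a b c x)"
  unfolding left_invertible_def is_left_inverse_def left_ideal_def mem_Collect_eq
proof
  assume "\<exists>s. b = s * (c * a * b) \<and> True"
  then obtain s where s: "b = s * (c * a * b)" by blast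
  have "s * (c * a * b) = s * c * a * b" by (simp only: mult.assoc)
  with s have "b = s * c * a * b" by (rule trans)
  then show "\<exists>x. (\<exists>s. x = s * c \<and> True) \<and> b = x * a * b" by blast
next
  assume "\<exists>x. (\<exists>s. x = s * c \<and> True) \<and> b = x * a * b"
  then obtain s where s: "b = s * c * a * b" by blast
  have "s * c * a * b = s * (c * a * b)" by (simp only: mult.assoc)
  with s have "b = s * (c * a * b)" by (rule trans)
  then show "\<exists>s. b = s * (c * a * b) \<and> True" by blast
qed

lemma is_core_inverseD:
  assumes "is_core_inverse a b c x"
  shows "c * a * x * c = c" "(c * a * x)\<^sup>\<star> = c * a * x" "x * (c * a * x) = x"
    "\<exists>u. x = b * u" "x * c * a * b = b"
proof -
  show cc: "c * a * x * c = c"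
    using assms by (simp add: is_core_inverse_def)
  have "x \<in> right_ideal x" "b \<in> right_ideal b" "x \<in> left_ideal x"
    unfolding right_ideal_def left_ideal_def
    by (simp_all, (metis mult_1_left mult_1_right)+)
  then have "x \<in> right_ideal b" "b \<in> right_ideal x" "x \<in> left_ideal (c\<^sup>\<star>)"
    using assms by (auto simp: is_core_inverse_def)
  then obtain u v t where u: "x = b * u" and v: "b = x * v" and t: "x = t * c\<^sup>\<star>"
    unfolding right_ideal_def left_ideal_def mem_Collect_eq by blast
  show "\<exists>u. x = b * u" using u by blast
  have "c\<^sup>\<star> * (c * a * x)\<^sup>\<star> = c\<^sup>\<star>"
    by (simp only: star_mult[symmetric] cc)
  then have "t * (c\<^sup>\<star> * (c * a * x)\<^sup>\<star>) = t * c\<^sup>\<star>"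
    by (simp only:)
  then have xx: "x * (c * a * x)\<^sup>\<star> = x"
    by (simp only: t[symmetric] mult.assoc[symmetric])
  then have *: "(c * a * x) * (c * a * x)\<^sup>\<star> = c * a * x"
    by (subst mult.assoc) (simp only:)
  have "(c * a * x)\<^sup>\<star> = ((c * a * x) * (c * a * x)\<^sup>\<star>)\<^sup>\<star>"
    by (simp only: *)
  also have "\<dots> = (c * a * x) * (c * a * x)\<^sup>\<star>"
    by (simp only: star_mult star_star)
  finally show sym: "(c * a * x)\<^sup>\<star> = c * a * x"
    by (simp only: *)
  show xcax: "x * (c * a * x) = x"
    using xx sym by simp
  have "x * c * a * b = x * c * a * (x * v)"
    by (simp only: v[symmetric])
  also have "\<dots> = x * (c * a * x) * v"
    by (simp only: mult.assoc)
  also have "\<dots> = b"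
    by (simp only: xcax v[symmetric])
  finally show "x * c * a * b = b" .
qed

lemma is_core_inverse_unique:
  assumes x: "is_core_inverse a b c x" and y: "is_core_inverse a b c y"
  shows "x = y"
proof -
  obtain u where u: "y = b * u" using is_core_inverseD(4)[OF y] by blast
  have yx: "x * (c * a * y) = y"
  proof -
    have "x * (c * a * y) = (x * c * a * b) * u"
      by (simp only: u mult.assoc)
    then show ?thesis
      by (simp only: is_core_inverseD(5)[OF x] u)
  qed
  have 1: "(c * a * x) * (c * a * y) = c * a * y"
    by (simp only: is_core_inverseD(1)[OF x] mult.assoc[symmetric])
  have "(c * a * y) * (c * a * x) = c * a * x"
    by (simp only: is_core_inverseD(1)[OF y] mult.assoc[symmetric])
  moreover have "(c * a * y) * (c * a * x) = c * a * y"
    using arg_cong[OF 1, of star]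
    by (simp only: star_mult[of "c * a * x"] is_core_inverseD(2)[OF x] is_core_inverseD(2)[OF y])
  ultimately have "c * a * y = c * a * x"
    by (rule trans[OF sym, rotated])
  then have "x * (c * a * y) = x * (c * a * x)"
    by (rule arg_cong)
  then show ?thesis
    by (simp only: yx is_core_inverseD(3)[OF x])
qed

lemma core_inverse_eqI: "is_core_inverse a b c x \<Longrightarrow> core_inverse a b c = x"
  unfolding core_inverse_def by (rule the_equality) (auto dest: is_core_inverse_unique)

end

theory Submission imports Defs begin

text \<open>If \<open>y\<close> is a \<open>{1,3}\<close>-inverse of \<open>c\<close>, the idempotent \<open>c y\<close> does not depend on \<open>y\<close>. When
  \<open>a\<close> is left \<open>(b,c)\<close>-invertible and \<open>a b s\<close> is a \<open>{1,3}\<close>-inverse of \<open>c\<close>, the element \<open>b s\<close> is the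
  core inverse. If moreover \<open>x = t c\<close> and \<open>x a b = b\<close>, then
  \<open>x y = t (c y) = t (c a b s) = b s\<close>. An equation \<open>c = r (c a b)\<^sup>\<star> c\<close> says exactly that
  \<open>a b r\<^sup>\<star>\<close> is a \<open>{1,3}\<close>-inverse of \<open>c\<close>, so \<open>b r\<^sup>\<star>\<close> is again the core inverse.\<close>

text \<open>Both products are self-adjoint idempotents generating the right ideal of
  \<open>c\<close>, so each fixes the other from the left. The involution reverses a product of the
  two, which turns one absorption into the other.\<close>

lemma inverses13_mult_eq:
  assumes y: "y \<in> inverses13 c" and z: "z \<in> inverses13 c"
  shows "c * y = c * z"
proof -
  have Y: "c * y * c = c" "(c * y)\<^sup>\<star> = c * y" and Z: "c * z * c = c" "(c * z)\<^sup>\<star> = c * z"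
    using y z by (auto simp: inverses13_def)
  have "c * y = (c * z) * (c * y)"
    by (simp only: mult.assoc[symmetric] Z)
  also have "\<dots> = ((c * y) * (c * z))\<^sup>\<star>"
    by (simp only: star_mult[of "c * y" "c * z"] Y Z)
  also have "\<dots> = c * z"
    by (simp only: mult.assoc[symmetric] Y Z)
  finally show ?thesis .
qed

text \<open>With \<open>p = c * y\<close>, the single equation gives
  \<open>p\<^sup>\<star> * p = p\<close>. The left side is self-adjoint, hence so is
  \<open>p\<close>, and the equation becomes \<open>c * y * c = c\<close>.\<close>

lemma inverses13_iff_star:
  "y \<in> inverses13 c \<longleftrightarrow> (c * y)\<^sup>\<star> * c = c"
proof
  assume "y \<in> inverses13 c"
  then show "(c * y)\<^sup>\<star> * c = c"
    by (simp add: inverses13_def)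
next
  assume c: "(c * y)\<^sup>\<star> * c = c"
  have idem: "(c * y)\<^sup>\<star> * (c * y) = c * y"
    by (simp only: mult.assoc[symmetric] c)
  have "(c * y)\<^sup>\<star> = ((c * y)\<^sup>\<star> * (c * y))\<^sup>\<star>"
    by (simp only: idem)
  also have "\<dots> = (c * y)\<^sup>\<star> * (c * y)"
    by (simp only: star_mult[of "(c * y)\<^sup>\<star>" "c * y"] star_star)
  finally have "(c * y)\<^sup>\<star> = c * y"
    by (simp only: idem)
  then show "y \<in> inverses13 c"
    using c by (simp add: inverses13_def)
qed

lemma right_ideal_subset_iff: "right_ideal x \<subseteq> right_ideal y \<longleftrightarrow> (\<exists>s. x = y * s)"
proof
  assume "right_ideal x \<subseteq> right_ideal y"
  moreover have "x * 1 \<in> right_ideal x"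
    unfolding right_ideal_def by blast
  ultimately show "\<exists>s. x = y * s"
    unfolding right_ideal_def mult_1_right by blast
next
  assume "\<exists>s. x = y * s"
  then show "right_ideal x \<subseteq> right_ideal y"
    unfolding right_ideal_def by (auto simp: mult.assoc)
qed

lemma left_ideal_subset_iff: "left_ideal x \<subseteq> left_ideal y \<longleftrightarrow> (\<exists>s. x = s * y)"
proof
  assume "left_ideal x \<subseteq> left_ideal y"
  moreover have "1 * x \<in> left_ideal x"
    unfolding left_ideal_def by blast
  ultimately show "\<exists>s. x = s * y"
    unfolding left_ideal_def mult_1_left by blast
next
  assume "\<exists>s. x = s * y"
  then show "left_ideal x \<subseteq> left_ideal y"
    unfolding left_ideal_def by (auto simp: mult.assoc[symmetric])
qed

lemma is_core_inverse_multI: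
  assumes b: "left_invertible a b c" and s: "a * b * s \<in> inverses13 c"
  shows "is_core_inverse a b c (b * s)"
proof -
  obtain t where t: "b = t * c * a * b"
    using b unfolding left_invertible_def left_ideal_def mem_Collect_eq mult.assoc by blast
  have c: "c * a * (b * s) * c = c" and sym: "(c * a * (b * s))\<^sup>\<star> = c * a * (b * s)"
    using s by (simp_all add: inverses13_def mult.assoc)
  \<comment> \<open>Expanding \<open>c\<close> inside \<open>b = t * c * a * b\<close> moves
    \<open>b * s\<close> to the front: this is the inclusion of \<open>right_ideal b\<close> in
    \<open>right_ideal (b * s)\<close>.\<close>
  have "b = t * (c * a * (b * s) * c) * a * b"
    by (simp only: c t[symmetric])
  also have "\<dots> = (t * c * a * b) * (s * (c * a * b))"
    by (simp only: mult.assoc)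
  also have "\<dots> = b * (s * (c * a * b))"
    by (simp only: t[symmetric])
  also have "\<dots> = (b * s) * (c * a * b)"
    by (simp only: mult.assoc)
  finally have 1: "b = (b * s) * (c * a * b)" .
  \<comment> \<open>Self-adjointness of \<open>c * a * (b * s)\<close> allows its leading
    \<open>c\<close> to reappear as a trailing \<open>c\<^sup>\<star>\<close>, so
    \<open>b * s\<close> lies in the left ideal of \<open>c\<^sup>\<star>\<close>.\<close>
  have "b * s = (t * c * a * b) * s"
    by (simp only: t[symmetric])
  also have "\<dots> = t * (c * (a * (b * s)))\<^sup>\<star>"
    by (simp only: sym[unfolded mult.assoc] mult.assoc)
  also have "\<dots> = (t * (a * (b * s))\<^sup>\<star>) * c\<^sup>\<star>"
    by (simp only: star_mult[of c] mult.assoc)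
  finally have 2: "b * s = (t * (a * (b * s))\<^sup>\<star>) * c\<^sup>\<star>" .
  \<comment> \<open>The converse inclusion of left ideals comes from applying the involution to
    \<open>c\<close>.\<close>
  have "c\<^sup>\<star> = (c * a * (b * s) * c)\<^sup>\<star>"
    by (simp only: c)
  also have "\<dots> = c\<^sup>\<star> * (c * a * (b * s))"
    by (simp only: star_mult[of "c * a * (b * s)"] sym)
  also have "\<dots> = (c\<^sup>\<star> * c * a) * (b * s)"
    by (simp only: mult.assoc)
  finally have 3: "c\<^sup>\<star> = (c\<^sup>\<star> * c * a) * (b * s)" .
  have "right_ideal (b * s) = right_ideal b"
    using 1 by (intro equalityI) (unfold right_ideal_subset_iff, blast+)
  moreover have "left_ideal (b * s) = left_ideal (c\<^sup>\<star>)"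
    using 2 3 by (intro equalityI) (unfold left_ideal_subset_iff, blast+)
  ultimately show ?thesis
    using c unfolding is_core_inverse_def by blast
qed

lemma core_invertible_iff:
  "core_invertible a b c \<longleftrightarrow> left_invertible a b c \<and> (\<exists>s. a * b * s \<in> inverses13 c)"
proof
  assume "core_invertible a b c"
  then obtain z where z: "is_core_inverse a b c z"
    by (auto simp: core_invertible_def)
  obtain u where u: "z = b * u"
    using is_core_inverseD(4)[OF z] by blast
  \<comment> \<open>The core inverse \<open>z\<close> supplies both witnesses: its right cofactor
    \<open>u\<close> over \<open>b\<close> serves as \<open>s\<close>, and \<open>z\<close> itself
    is the left multiplier of \<open>c * a * b\<close>.\<close>
  have "a * b * u \<in> inverses13 c"
    using is_core_inverseD(1,2)[OF z] by (simp add: inverses13_def u mult.assoc)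
  moreover have "b = z * (c * a * b)"
    using is_core_inverseD(5)[OF z, symmetric] by (simp only: mult.assoc)
  then have "left_invertible a b c"
    unfolding left_invertible_def left_ideal_def by blast
  ultimately show "left_invertible a b c \<and> (\<exists>s. a * b * s \<in> inverses13 c)"
    by blast
qed (auto simp: core_invertible_def dest: is_core_inverse_multI)

lemma core_inverse_eq_left_inverse_mult:
  assumes "core_invertible a b c" and x: "is_left_inverse a b c x" and y: "y \<in> inverses13 c"
  shows "core_inverse a b c = x * y"
proof -
  obtain s where l: "left_invertible a b c" and s: "a * b * s \<in> inverses13 c"
    using assms(1) by (auto simp: core_invertible_iff)
  obtain t where t: "x = t * c" and b: "b = x * a * b"
    using x unfolding is_left_inverse_def left_ideal_def by blast
  \<comment> \<open>Since \<open>x\<close> is a left multiple of \<open>c\<close>, the product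
    depends on \<open>y\<close> only through \<open>c * y\<close>.\<close>
  have "x * y = t * (c * y)"
    by (simp only: t mult.assoc)
  also have "\<dots> = t * (c * (a * b * s))"
    by (simp only: inverses13_mult_eq[OF y s])
  also have "\<dots> = (x * a * b) * s"
    by (simp only: t mult.assoc)
  also have "\<dots> = b * s"
    by (simp only: b[symmetric])
  finally show ?thesis
    using core_inverse_eqI[OF is_core_inverse_multI[OF l s]] by simp
qed

lemma mult_in_inverses13_iff:
  "a * b * s \<in> inverses13 c \<longleftrightarrow> c = s\<^sup>\<star> * (c * a * b)\<^sup>\<star> * c"
proof -
  have "(c * (a * b * s))\<^sup>\<star> = s\<^sup>\<star> * (c * a * b)\<^sup>\<star>"
    by (simp only: star_mult[of _ s, symmetric] mult.assoc)
  then show ?thesis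
    unfolding inverses13_iff_star by (metis (no_types))
qed

theorem corollary3p20:
  fixes a b c :: "'a::star_monoid"
  shows "(core_invertible a b c \<longleftrightarrow>
            left_invertible a b c \<and> invertible13 c \<and> (\<exists>s. a * b * s \<in> inverses13 c))
       \<and> (core_invertible a b c \<longrightarrow>
            (\<forall>x y. is_left_inverse a b c x \<and> y \<in> inverses13 c \<longrightarrow> core_inverse a b c = x * y)
          \<and> (\<exists>r. c = r * (c * a * b)\<^sup>\<star> * c)
          \<and> (\<forall>r. c = r * (c * a * b)\<^sup>\<star> * c \<longrightarrow> core_inverse a b c = b * r\<^sup>\<star>))"
proof (intro conjI impI allI)
  show "core_invertible a b c \<longleftrightarrow>
      left_invertible a b c \<and> invertible13 c \<and> (\<exists>s. a * b * s \<in> inverses13 c)"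
    by (auto simp: core_invertible_iff invertible13_def)
next
  fix x y
  assume "core_invertible a b c" "is_left_inverse a b c x \<and> y \<in> inverses13 c"
  then show "core_inverse a b c = x * y"
    by (blast intro: core_inverse_eq_left_inverse_mult)
next
  assume "core_invertible a b c"
  \<comment> \<open>Take \<open>r = s\<^sup>\<star>\<close>.\<close>
  then show "\<exists>r. c = r * (c * a * b)\<^sup>\<star> * c"
    unfolding core_invertible_iff mult_in_inverses13_iff by blast
next
  fix r
  assume inv: "core_invertible a b c" and r: "c = r * (c * a * b)\<^sup>\<star> * c"
  \<comment> \<open>Conversely every \<open>r\<close> is the star of
    \<open>s = r\<^sup>\<star>\<close>.\<close>
  have "a * b * r\<^sup>\<star> \<in> inverses13 c"
    unfolding mult_in_inverses13_iff star_star by (rule r)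
  with inv show "core_inverse a b c = b * r\<^sup>\<star>"
    by (blast intro: core_inverse_eqI is_core_inverse_multI dest: core_invertible_iff[THEN iffD1])
qed

end
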